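(* Let $a_n$ (for $n\ge 0$) denote the number of $n$-colour self-inverse compositions of $2n+1$. For $n\ge1$, let $b_n$ denote the number of $n$-colour self-inverse compositions of $2n$ into an even number of parts, $c_n$ the number of $n$-colour self-inverse compositions of $2n$ into an odd number of parts, and $d_n=b_n+c_n$ the number of all $n$-colour self-inverse compositions of $2n$. Then: (i) $a_0=1$, $a_1=4$ and $a_n=3a_{n-1}-a_{n-2}$ for $n\ge2$; (ii) $b_1=1$, $b_2=3$ and $b_n=3b_{n-1}-b_{n-2}$ for $n>2$; (iii) $c_1=2$, $c_2=6$ and $c_n=3c_{n-1}-c_{n-2}$ for $n>2$; (iv) $d_1=3$, $d_2=9$ and $d_n=3d_{n-1}-d_{n-2}$ for $n>2$.
   Context: An $n$-colour composition of a positive integer $N$ is a finite ordered sequence of coloured parts $(h_1)_{t_1}(h_2)_{t_2}\cdots(h_m)_{t_m}$ with each $h_i\ge 1$ an integer, $h_1+\cdots+h_m=N$, and each colour $t_i\in\{1,\dots,h_i\}$ (so a part of size $h$ comes in $h$ different colours); $m$ is its number of parts. The "$n$" in the term "$n$-colour" is part of the name and unrelated to the index $n$ of the sequences. An $n$-colour composition is self-inverse if the sequence of coloured parts read from left to right is identical with the sequence read from right to left, i.e. $h_i=h_{m+1-i}$ and $t_i=t_{m+1-i}$ for all $i$. *)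

theory Defs
  imports Main
begin

text \<open>A coloured part \<open>h\<^sub>t\<close> is represented by the pair \<open>(h, t)\<close>
  of its size and its colour.\<close>

type_synonym coloured_part = "nat \<times> nat"

definition n_colour_composition :: "nat \<Rightarrow> coloured_part list \<Rightarrow> bool" where
  "n_colour_composition N c \<longleftrightarrow>
     (\<forall>(h, t) \<in> set c. 1 \<le> h \<and> t \<in> {1..h}) \<and> sum_list (map fst c) = N"

definition self_inverse :: "coloured_part list \<Rightarrow> bool" where
  "self_inverse c \<longleftrightarrow> rev c = c"

definition self_inverse_compositions :: "nat \<Rightarrow> coloured_part list set" where
  "self_inverse_compositions N = {c. n_colour_composition N c \<and> self_inverse c}"

lemma length_n_colour_composition:
  "n_colour_composition N c \<Longrightarrow> length c \<le> N"
  unfolding n_colour_composition_def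
  by (induction c arbitrary: N) fastforce+

lemma finite_n_colour_compositions: "finite {c. n_colour_composition N c}"
proof (rule finite_subset)
  show "finite {c. set c \<subseteq> {..N} \<times> {..N} \<and> length c \<le> N}"
    by (rule finite_lists_length_le) simp
  have "h \<le> N \<and> t \<le> N" if c: "n_colour_composition N c" and ht: "(h, t) \<in> set c" for c h t
  proof -
    have "h \<in> set (map fst c)"
      using ht by force
    then have "h \<le> N"
      using c member_le_sum_list unfolding n_colour_composition_def by blast
    moreover have "t \<le> h"
      using c ht unfolding n_colour_composition_def by auto
    ultimately show ?thesis by simp
  qed
  then show "{c. n_colour_composition N c} \<subseteq> {c. set c \<subseteq> {..N} \<times> {..N} \<and> length c \<le> N}"
    using length_n_colour_composition by auto
qed

lemma finite_self_inverse_compositions: "finite (self_inverse_compositions N)"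
  by (rule finite_subset[OF _ finite_n_colour_compositions[of N]])
    (auto simp: self_inverse_compositions_def)

definition a_seq :: "nat \<Rightarrow> nat" where
  "a_seq n = card (self_inverse_compositions (2 * n + 1))"

text \<open>\<open>b_seq\<close>, \<open>c_seq\<close> and \<open>d_seq\<close> are meant for
  \<open>n \<ge> 1\<close> only: at \<open>n = 0\<close> the empty list is the one composition.\<close>

definition b_seq :: "nat \<Rightarrow> nat" where
  "b_seq n = card {x \<in> self_inverse_compositions (2 * n). even (length x)}"

definition c_seq :: "nat \<Rightarrow> nat" where
  "c_seq n = card {x \<in> self_inverse_compositions (2 * n). odd (length x)}"

definition d_seq :: "nat \<Rightarrow> nat" where
  "d_seq n = b_seq n + c_seq n"

lemma d_seq_eq_card: "d_seq n = card (self_inverse_compositions (2 * n))"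
proof -
  let ?S = "self_inverse_compositions (2 * n)"
  have "?S = {x \<in> ?S. even (length x)} \<union> {x \<in> ?S. odd (length x)}"
    by auto
  moreover have "card ({x \<in> ?S. even (length x)} \<union> {x \<in> ?S. odd (length x)})
      = card {x \<in> ?S. even (length x)} + card {x \<in> ?S. odd (length x)}"
    by (rule card_Un_disjoint) (auto simp: finite_self_inverse_compositions)
  ultimately show ?thesis
    by (simp add: d_seq_def b_seq_def c_seq_def)
qed

end

theory Submission
  imports Defs
begin

text \<open>
  A palindrome is determined by its left half and, when its length is odd, its middle part.
  Write \<open>T k\<close> for the number of all \<open>n\<close>-colour compositions of \<open>k\<close>. The palindromes of
  even length and weight \<open>2 * n\<close> correspond to the compositions of \<open>n\<close>, so \<open>b n = T n\<close>. In a
  palindrome of odd length and weight \<open>M\<close> whose left half has weight \<open>k\<close>, the middle part has size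
  \<open>M - 2 * k\<close>, hence as many possible colours, so there are
  \<open>\<Sum>k | 2 * k < M. (M - 2 * k) * T k\<close> of them.

  Splitting off the first part of a composition gives \<open>T n = (\<Sum>k<n. (n - k) * T k)\<close> for
  \<open>n \<ge> 1\<close>. This convolution with the sizes \<open>1, 2, 3, \<dots>\<close> evaluates the two odd-length
  sums: for \<open>n \<ge> 1\<close> they give \<open>c n = 2 * T n\<close>, and \<open>a n = T n + T (n + 1)\<close>
  because \<open>2 * (n - k) + 1 = (n - k) + (n + 1 - k)\<close>. Taking differences of the convolution
  twice gives \<open>T (n + 2) = 3 * T (n + 1) - T n\<close> for \<open>n \<ge> 1\<close>, and all four sequences
  inherit this recurrence by linearity. The convolution fails at \<open>n = 0\<close>, where it yields
  \<open>0\<close> while \<open>T 0 = 1\<close>. Hence \<open>T 2 = 3\<close> is an initial value, and the step of the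
  \<open>a\<close>-recurrence that involves \<open>a 0 = 1\<close> is checked on numbers.
\<close>

section \<open>Counting all compositions\<close>

definition compositions :: "nat \<Rightarrow> coloured_part list set" where
  "compositions N = {c. n_colour_composition N c}"

lemma finite_compositions [simp]: "finite (compositions N)"
  by (simp add: compositions_def finite_n_colour_compositions)

lemma compositions_iff:
  "c \<in> compositions N \<longleftrightarrow>
     (\<forall>p\<in>set c. snd p \<in> {1..fst p}) \<and> sum_list (map fst c) = N"
  by (force simp: compositions_def n_colour_composition_def)

lemma card_compositions_0: "card (compositions 0) = 1"
proof -
  have "compositions 0 = {[]}"
    using length_n_colour_composition[of 0]
    by (auto simp: compositions_def n_colour_composition_def)
  then show ?thesis by simp
qed

text \<open>Removing the first part of a composition, or the middle part of a palindrome of odd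
  length, leaves such a triple: the weight \<open>k\<close> of what remains (of its left half, for a
  palindrome) determines the size \<open>s k\<close> of the removed part.\<close>

lemma card_weight_colour_composition:
  assumes "finite K"
  shows "card (SIGMA k:K. {1..s k} \<times> compositions k) = (\<Sum>k\<in>K. s k * card (compositions k))"
  using assms by (simp add: card_cartesian_product)

text \<open>Split off the first part, whose size is \<open>n - k\<close> when the rest has weight \<open>k\<close>.
  The empty composition has no first part, so \<open>n\<close> must be positive.\<close>

lemma card_compositions:
  assumes "0 < n"
  shows "card (compositions n) = (\<Sum>k<n. (n - k) * card (compositions k))"
proof -
  let ?A = "SIGMA k:{..<n}. {1..n - k} \<times> compositions k"
  let ?f = "\<lambda>(k, t, c). (n - k, t) # c"
  have inj: "inj_on ?f ?A"
    by (auto simp: inj_on_def compositions_iff)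
  have image: "?f ` ?A = compositions n"
  proof (intro equalityI subsetI)
    fix x assume "x \<in> ?f ` ?A"
    then show "x \<in> compositions n" by (fastforce simp: compositions_iff)
  next
    fix x assume x: "x \<in> compositions n"
    with assms obtain h t c where "x = (h, t) # c"
      by (cases x) (auto simp: compositions_iff)
    with x have "(n - h, t, c) \<in> ?A" "x = ?f (n - h, t, c)"
      by (auto simp: compositions_iff)
    then show "x \<in> ?f ` ?A" by (rule rev_image_eqI)
  qed
  have "card (compositions n) = card ?A"
    using card_image[OF inj] unfolding image .
  then show ?thesis by (simp only: card_weight_colour_composition finite_lessThan)
qed

text \<open>Passing from \<open>n\<close> to \<open>n + 1\<close> in the convolution raises every factor \<open>n - k\<close> by
  one, so the first difference is a plain partial sum.\<close>

lemma card_compositions_Suc: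
  assumes "0 < n"
  shows "card (compositions (Suc n)) = card (compositions n) + (\<Sum>k\<le>n. card (compositions k))"
proof -
  have "card (compositions (Suc n)) = (\<Sum>k\<le>n. (Suc n - k) * card (compositions k))"
    by (simp only: card_compositions[OF zero_less_Suc] lessThan_Suc_atMost)
  also have "\<dots> = (\<Sum>k\<le>n. (n - k) * card (compositions k) + card (compositions k))"
    by (rule sum.cong) (auto simp: Suc_diff_le)
  also have "\<dots> = (\<Sum>k<n. (n - k) * card (compositions k)) + (\<Sum>k\<le>n. card (compositions k))"
    by (simp add: sum.distrib flip: lessThan_Suc_atMost)
  finally show ?thesis by (simp only: card_compositions[OF assms])
qed

lemma card_compositions_recurrence:
  assumes "0 < n"
  shows "card (compositions (Suc (Suc n))) + card (compositions n)
       = 3 * card (compositions (Suc n))"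
  using card_compositions_Suc[OF assms] card_compositions_Suc[of "Suc n"] by simp

lemma card_compositions_1: "card (compositions (Suc 0)) = 1"
  by (simp add: card_compositions card_compositions_0)

lemma card_compositions_2: "card (compositions 2) = 3"
  using card_compositions_Suc[of 1]
  by (simp add: card_compositions_0 card_compositions_1 numeral_2_eq_2)

section \<open>Halving palindromes\<close>

lemma even_palindrome_halves:
  assumes "rev x = x" "even (length x)"
  obtains c where "x = c @ rev c"
proof
  let ?n = "length x div 2"
  have "drop ?n x = drop ?n (rev x)" using assms by simp
  also have "\<dots> = rev (take (length x - ?n) x)" by (simp add: drop_rev)
  also have "length x - ?n = ?n" using assms(2) by auto
  finally show "x = take ?n x @ rev (take ?n x)" by (metis append_take_drop_id)
qed

lemma odd_palindrome_halves:
  assumes "rev x = x" "odd (length x)"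
  obtains c p where "x = c @ p # rev c"
proof
  let ?n = "length x div 2"
  have "drop (Suc ?n) x = drop (Suc ?n) (rev x)" using assms by simp
  also have "\<dots> = rev (take (length x - Suc ?n) x)" by (simp add: drop_rev)
  also have "length x - Suc ?n = ?n" using assms(2) by presburger
  finally have "drop (Suc ?n) x = rev (take ?n x)" .
  moreover have "?n < length x" using assms(2) by presburger
  ultimately show "x = take ?n x @ x ! ?n # rev (take ?n x)"
    by (metis id_take_nth_drop)
qed

lemma self_inverse_compositions_iff:
  "x \<in> self_inverse_compositions N \<longleftrightarrow> x \<in> compositions N \<and> rev x = x"
  by (simp add: self_inverse_compositions_def compositions_def self_inverse_def)

lemma even_self_inverse_iff:
  "c @ rev c \<in> self_inverse_compositions N \<longleftrightarrow> even N \<and> c \<in> compositions (N div 2)"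
  by (auto simp: self_inverse_compositions_iff compositions_iff rev_map[symmetric])

lemma odd_self_inverse_iff:
  "c @ (h, t) # rev c \<in> self_inverse_compositions N \<longleftrightarrow>
     (\<exists>k. N = 2 * k + h \<and> t \<in> {1..h} \<and> c \<in> compositions k)"
  by (auto simp: self_inverse_compositions_iff compositions_iff rev_map[symmetric])

lemma b_seq_eq: "b_seq n = card (compositions n)"
proof -
  have "{x \<in> self_inverse_compositions (2 * n). even (length x)}
      = (\<lambda>c. c @ rev c) ` compositions n"
  proof (intro equalityI subsetI)
    fix x assume x: "x \<in> {x \<in> self_inverse_compositions (2 * n). even (length x)}"
    then obtain c where "x = c @ rev c"
      using even_palindrome_halves self_inverse_compositions_iff by blast
    with x show "x \<in> (\<lambda>c. c @ rev c) ` compositions n"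
      by (simp add: even_self_inverse_iff)
  qed (auto simp: even_self_inverse_iff)
  moreover have "inj_on (\<lambda>c. c @ rev c) (compositions n)"
  proof (rule inj_onI)
    fix c d :: "coloured_part list"
    assume eq: "c @ rev c = d @ rev d"
    have "length c = length d"
      using arg_cong[OF eq, of length] by simp
    with eq show "c = d" by simp
  qed
  ultimately show ?thesis by (simp add: b_seq_def card_image)
qed

text \<open>The weight \<open>k\<close> of the left half fixes the size \<open>N - 2 * k\<close> of the middle part.\<close>

lemma card_odd_self_inverse:
  "card {x \<in> self_inverse_compositions N. odd (length x)}
     = (\<Sum>k | 2 * k < N. (N - 2 * k) * card (compositions k))"
proof -
  let ?A = "SIGMA k:{k. 2 * k < N}. {1..N - 2 * k} \<times> compositions k"
  let ?f = "\<lambda>(k, t, c). c @ (N - 2 * k, t) # rev c"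
  let ?S = "{x \<in> self_inverse_compositions N. odd (length x)}"
  have halves_inj: "c = d \<and> p = q" if "c @ p # rev c = d @ q # rev d"
    for c d :: "coloured_part list" and p q
  proof -
    have "length c = length d"
      using arg_cong[OF that, of length] by simp
    with that show ?thesis by simp
  qed
  have inj: "inj_on ?f ?A"
    by (force simp: inj_on_def compositions_iff dest!: halves_inj)
  have image: "?f ` ?A = ?S"
  proof (intro equalityI subsetI)
    fix x assume "x \<in> ?f ` ?A"
    then obtain k t c where x_eq: "x = c @ (N - 2 * k, t) # rev c" and "2 * k < N"
      "t \<in> {1..N - 2 * k}" "c \<in> compositions k"
      by auto
    moreover from this have "N = 2 * k + (N - 2 * k)" by simp
    ultimately have "x \<in> self_inverse_compositions N"
      using odd_self_inverse_iff by blast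
    with x_eq show "x \<in> ?S" by simp
  next
    fix x assume x: "x \<in> ?S"
    then obtain c p where "x = c @ p # rev c"
      using odd_palindrome_halves self_inverse_compositions_iff by blast
    then obtain h t where eq: "x = c @ (h, t) # rev c"
      by (cases p) auto
    with x obtain k where "N = 2 * k + h" "t \<in> {1..h}" "c \<in> compositions k"
      by (auto simp: odd_self_inverse_iff)
    with eq have "(k, t, c) \<in> ?A" "x = ?f (k, t, c)" by auto
    then show "x \<in> ?f ` ?A" by (rule rev_image_eqI)
  qed
  have "card ?S = card ?A"
    using card_image[OF inj] unfolding image .
  moreover have "finite {k. 2 * k < N}"
    by (rule finite_subset[of _ "{..<N}"]) auto
  ultimately show ?thesis by (simp only: card_weight_colour_composition)
qed

section \<open>The sequences in terms of the number of compositions\<close>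

lemma c_seq_eq:
  assumes "0 < n"
  shows "c_seq n = 2 * card (compositions n)"
proof -
  have "c_seq n = (\<Sum>k<n. (2 * n - 2 * k) * card (compositions k))"
    by (simp add: c_seq_def card_odd_self_inverse lessThan_def)
  also have "\<dots> = 2 * (\<Sum>k<n. (n - k) * card (compositions k))"
    by (simp add: sum_distrib_left mult.assoc flip: right_diff_distrib')
  finally show ?thesis by (simp only: card_compositions[OF assms])
qed

text \<open>A palindrome of odd weight has odd length, since two equal halves have even total weight.\<close>

lemma a_seq_eq_sum: "a_seq n = (\<Sum>k\<le>n. (2 * n + 1 - 2 * k) * card (compositions k))"
proof -
  have "odd (length x)" if "x \<in> self_inverse_compositions (2 * n + 1)" for x
  proof
    assume "even (length x)"
    with that obtain c where "x = c @ rev c"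
      using even_palindrome_halves self_inverse_compositions_iff by blast
    with that show False by (simp add: even_self_inverse_iff)
  qed
  then have "self_inverse_compositions (2 * n + 1)
      = {x \<in> self_inverse_compositions (2 * n + 1). odd (length x)}"
    by auto
  moreover have "{k. 2 * k < 2 * n + 1} = {..n}" by auto
  ultimately show ?thesis
    using card_odd_self_inverse[of "2 * n + 1"] by (simp only: a_seq_def)
qed

lemma a_seq_eq:
  assumes "0 < n"
  shows "a_seq n = card (compositions n) + card (compositions (Suc n))"
proof -
  have "a_seq n = (\<Sum>k\<le>n. (n - k) * card (compositions k) + (Suc n - k) * card (compositions k))"
    unfolding a_seq_eq_sum
  proof (rule sum.cong[OF refl])
    fix k assume "k \<in> {..n}"
    then have "2 * n + 1 - 2 * k = (n - k) + (Suc n - k)" by auto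
    then show "(2 * n + 1 - 2 * k) * card (compositions k)
        = (n - k) * card (compositions k) + (Suc n - k) * card (compositions k)"
      by (simp only: distrib_right)
  qed
  also have "\<dots> = (\<Sum>k<n. (n - k) * card (compositions k))
      + (\<Sum>k<Suc n. (Suc n - k) * card (compositions k))"
    by (simp add: sum.distrib flip: lessThan_Suc_atMost)
  finally show ?thesis
    by (simp only: card_compositions[OF assms] card_compositions[OF zero_less_Suc])
qed

lemma a_seq_0: "a_seq 0 = 1"
  by (simp add: a_seq_eq_sum card_compositions_0)

theorem theorem3p1:
  shows
    "(a_seq 0 = 1 \<and> a_seq 1 = 4 \<and>
       (\<forall>n\<ge>2. int (a_seq n) = 3 * int (a_seq (n - 1)) - int (a_seq (n - 2)))) \<and>
     (b_seq 1 = 1 \<and> b_seq 2 = 3 \<and>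
       (\<forall>n>2. int (b_seq n) = 3 * int (b_seq (n - 1)) - int (b_seq (n - 2)))) \<and>
     (c_seq 1 = 2 \<and> c_seq 2 = 6 \<and>
       (\<forall>n>2. int (c_seq n) = 3 * int (c_seq (n - 1)) - int (c_seq (n - 2)))) \<and>
     (d_seq 1 = 3 \<and> d_seq 2 = 9 \<and>
       (\<forall>n>2. int (d_seq n) = 3 * int (d_seq (n - 1)) - int (d_seq (n - 2))))"
proof -
  let ?T = "\<lambda>n. card (compositions n)"
  have T1: "?T 1 = 1" and T2: "?T 2 = 3"
    by (simp_all add: card_compositions_1 card_compositions_2)
  have rec: "int (?T n) = 3 * int (?T (n - 1)) - int (?T (n - 2))" if "2 < n" for n
  proof -
    have "Suc (Suc (n - 2)) = n" "Suc (n - 2) = n - 1" using that by auto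
    then show ?thesis using card_compositions_recurrence[of "n - 2"] that by simp
  qed
  have a1: "a_seq 1 = 4"
    using a_seq_eq[of 1] T1 T2 by (simp add: numeral_2_eq_2)
  have a_rec: "int (a_seq n) = 3 * int (a_seq (n - 1)) - int (a_seq (n - 2))" if "2 \<le> n" for n
  proof (cases "n = 2")
    case True
    \<comment> \<open>\<open>a_seq_eq\<close> does not hold at 0, where it would give 2 instead of 1.\<close>
    moreover have "?T 3 = 8"
      using rec[of 3] T1 T2 by simp
    then have "a_seq 2 = 11"
      using a_seq_eq[of 2] T2 by (simp add: numeral_3_eq_3)
    ultimately show ?thesis
      using a_seq_0 a1 by simp
  next
    case False
    with that have n: "2 < n" by simp
    then have "Suc (n - 1) = n" "Suc (n - 2) = n - 1" by auto
    then show ?thesis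
      using n rec[of n] rec[of "Suc n"] by (simp add: a_seq_eq)
  qed
  have c_rec: "int (c_seq n) = 3 * int (c_seq (n - 1)) - int (c_seq (n - 2))" if "2 < n" for n
    using that rec[OF that] by (simp add: c_seq_eq)
  have c12: "c_seq 1 = 2" "c_seq 2 = 6"
    using T1 T2 by (simp_all add: c_seq_eq)
  show ?thesis
    using a_seq_0 a1 a_rec T1 T2 rec c12 c_rec by (simp add: b_seq_eq d_seq_def)
qed

end
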